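(* For every real $r > \tfrac{1}{2}$ there exists $d_0 = d_0(r)$ such that for every integer $d \ge d_0$ there is a set $\Omega \subset S_r^{d-1}$ with $\operatorname{diam}\Omega = 1$ which cannot be partitioned into $d+1$ parts each of diameter strictly smaller than $1$. Equivalently, $f_r(d) > d+1$ for all $d \ge d_0$.
   Context: For $\Omega \subset \mathbb{R}^d$, $\operatorname{diam}\Omega = \sup_{x,y\in\Omega}|x-y|$ (Euclidean distance). $f(\Omega)$ denotes the minimum number $f$ such that $\Omega = \Omega_1\cup\dots\cup\Omega_f$ with $\operatorname{diam}\Omega_i < \operatorname{diam}\Omega$ for all $i$. $S_r^{d-1}\subset\mathbb{R}^d$ is the sphere of radius $r$ centred at the origin, and $f_r(d) = \max\{ f(\Omega) : \Omega \subset S_r^{d-1},\ \operatorname{diam}\Omega = 1\}$. *)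

theory Defs
  imports "HOL-Analysis.Analysis"
begin

definition euclid_pts :: "nat \<Rightarrow> (nat \<Rightarrow> real) set" where
  "euclid_pts d = {x. \<forall>i\<ge>d. x i = 0}"

definition edist :: "nat \<Rightarrow> (nat \<Rightarrow> real) \<Rightarrow> (nat \<Rightarrow> real) \<Rightarrow> real" where
  "edist d x y = sqrt (\<Sum>i<d. (x i - y i)^2)"

definition sphere_d :: "nat \<Rightarrow> real \<Rightarrow> (nat \<Rightarrow> real) set" where
  "sphere_d d r = {x \<in> euclid_pts d. sqrt (\<Sum>i<d. (x i)^2) = r}"

text \<open>Euclidean diameter (supremum of pairwise distances); 0 for the empty set,
  as for the library's diameter.\<close>
definition diam_d :: "nat \<Rightarrow> (nat \<Rightarrow> real) set \<Rightarrow> real" where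
  "diam_d d S = (if S = {} then 0 else (SUP p\<in>S \<times> S. edist d (fst p) (snd p)))"

end

theory Submission
  imports Defs
begin

text \<open>
  Take all \<open>k\<close>-subsets of a \<open>2k\<close>-set, with \<open>k = q + s\<close>, \<open>q = M s\<close> and \<open>M\<close>, \<open>s\<close> powers of two, and let \<open>t\<close>
  be the inner product of the corresponding normalised \<open>\<plusminus>1\<close>-vectors.  The value \<open>t = -\<tau>\<close> with
  \<open>\<tau> = (M - 1) / (M + 1)\<close> occurs exactly when two sets meet in \<open>s\<close> points, and by the
  Frankl--Wilson argument modulo \<open>q\<close> a family avoiding intersection \<open>s\<close> has at most
  \<open>\<Sum>j<q. (2k choose j)\<close> members, an exponentially small proportion.  For even \<open>L\<close>, the kernel
  \<open>t ^ L + L \<tau> ^ (L - 1) t\<close> is the Gram kernel of the vectors made of an \<open>L\<close>-th tensor power and a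
  multiple of the original vector; it is minimal at \<open>t = -\<tau>\<close>, so the pairs at maximal distance are
  exactly those meeting in \<open>s\<close> points.  As \<open>\<tau>\<close> tends to 1 and then \<open>L\<close> to infinity, the ratio of
  radius to diameter tends to 1/2.  The dimension is polynomial in \<open>s\<close>, whereas the number of parts
  needed grows exponentially.
\<close>

section \<open>Binomial coefficients modulo 2\<close>

text \<open>Modulo 2, \<open>(1 + x) ^ 2 = 1 + x ^ 2\<close>: applying Pascal's rule twice produces
  a middle term with coefficient 2, which drops out.\<close>

lemma binomial_even_lucas:
  "(odd ((2 * m) choose (2 * j)) \<longleftrightarrow> odd (m choose j)) \<and> even ((2 * m) choose (2 * j + 1))"
proof (induction m arbitrary: j)
  case 0
  then show ?case by (cases j) auto
next
  case (Suc m)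
  show ?case
  proof (cases j)
    case 0
    then show ?thesis by simp
  next
    case (Suc i)
    have "(2 * Suc m) choose (2 * j) =
        (2*m choose (2*i)) + 2 * (2*m choose (2*i+1)) + (2*m choose (2*Suc i))"
      by (simp add: Suc)
    moreover have "(2 * Suc m) choose (2 * j + 1) =
        (2*m choose (2*i+1)) + 2 * (2*m choose (2*Suc i)) + (2*m choose (2*Suc i + 1))"
      by (simp add: Suc)
    ultimately show ?thesis
      using Suc.IH[of i] Suc.IH[of "Suc i"] Suc by auto
  qed
qed

text \<open>All \<open>a\<close> binary digits of \<open>2 ^ a - 1\<close> are ones, so by Lucas the
  coefficient is odd exactly when the last \<open>a\<close> digits of \<open>m\<close> are ones too.
  The induction strips the last digit of \<open>m\<close>.\<close>

lemma odd_binomial_two_power_minus_one: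
  "odd (m choose (2 ^ a - 1)) \<longleftrightarrow> 2 ^ a dvd m + 1"
proof (induction a arbitrary: m)
  case 0
  then show ?case by simp
next
  case (Suc a)
  have pow: "(2::nat) ^ Suc a - 1 = 2 * (2 ^ a - 1) + 1"
    by (cases "(2::nat) ^ a") simp_all
  consider u where "m = 2 * u" | u where "m = 2 * u + 1"
    by (metis evenE oddE)
  then show ?case
  proof cases
    case 1
    have "odd (m + 1)" using 1 by simp
    hence "\<not> 2 ^ Suc a dvd m + 1"
      using dvd_trans[of 2 "2 ^ Suc a" "m + 1"] by fastforce
    then show ?thesis
      unfolding pow using 1 binomial_even_lucas by blast
  next
    case 2
    have "m choose (2 * (2 ^ a - 1) + 1) =
        (2 * u choose (2 * (2 ^ a - 1))) + (2 * u choose (2 * (2 ^ a - 1) + 1))"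
      by (simp add: 2)
    hence "odd (m choose (2 ^ Suc a - 1)) \<longleftrightarrow> odd (u choose (2 ^ a - 1))"
      unfolding pow using binomial_even_lucas[of u "2 ^ a - 1"] by simp
    moreover have "m + 1 = 2 * (u + 1)" using 2 by simp
    hence "2 ^ Suc a dvd m + 1 \<longleftrightarrow> 2 ^ a dvd u + 1"
      unfolding power_Suc by (simp only:) (rule nat_mult_dvd_cancel1, simp)
    ultimately show ?thesis using Suc.IH by blast
  qed
qed

section \<open>Frankl-Wilson bound modulo a power of two\<close>

lemma card_subsets_less:
  assumes "finite V"
  shows "card {J. J \<subseteq> V \<and> card J < q} = (\<Sum>j<q. card V choose j)"
proof -
  have "{J. J \<subseteq> V \<and> card J < q} = (\<Union>j<q. {J. J \<subseteq> V \<and> card J = j})" by auto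
  also have "card \<dots> = (\<Sum>j<q. card {J. J \<subseteq> V \<and> card J = j})"
    using assms by (intro card_UN_disjoint) auto
  finally show ?thesis using assms by (simp add: n_subsets)
qed

text \<open>Working over the field with two elements, linear independence is replaced by pigeonhole: a subfamily
  is determined by the parities of its incidences with the sets of size less than \<open>q\<close>, because
  the parity of \<open>card (A \<inter> B) + w choose (q - 1)\<close> detects \<open>A = B\<close>.\<close>
lemma frankl_wilson_two_power:
  fixes V :: "'a set" and k a :: nat
  defines "q \<equiv> 2 ^ a"
  assumes V: "finite V"
    and sub: "\<And>A. A \<in> F \<Longrightarrow> A \<subseteq> V \<and> card A = k"
    and avoid: "\<And>A B. A \<in> F \<Longrightarrow> B \<in> F \<Longrightarrow> A \<noteq> B \<Longrightarrow> card (A \<inter> B) mod q \<noteq> k mod q"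
  shows "card F \<le> (\<Sum>j<q. card V choose j)"
proof -
  define S where "S = {J. J \<subseteq> V \<and> card J < q}"
  \<comment> \<open>A natural number congruent to \<open>- k - 1\<close> modulo \<open>q\<close>:
    then \<open>q\<close> divides \<open>card (A \<inter> B) + w + 1\<close> exactly when
    \<open>card (A \<inter> B)\<close> and \<open>k\<close> agree modulo \<open>q\<close>.\<close>
  define w where "w = (q - 1) * (k + 1)"
  define \<phi> where "\<phi> G = {J \<in> S. odd (card {A \<in> G. J \<subseteq> A})}" for G :: "'a set set"
  have q: "q \<ge> 1" by (simp add: q_def)
  have finS: "finite S" using V by (simp add: S_def)
  have finF: "finite F"
    by (rule finite_subset[of _ "Pow V"]) (use sub V in auto)
  \<comment> \<open>Vandermonde's identity, grouped by the subsets \<open>J\<close> of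
    \<open>A \<inter> B\<close>, separates \<open>A\<close> from \<open>B\<close>: the value becomes
    a bilinear form in their incidence vectors over \<open>S\<close>.\<close>
  have expand: "(card (A \<inter> B) + w) choose (q - 1) =
      (\<Sum>J\<in>S. (w choose (q - 1 - card J)) * of_bool (J \<subseteq> B) * of_bool (J \<subseteq> A))"
    if "A \<subseteq> V" for A B
  proof -
    have fin: "finite (A \<inter> B)" using that V by (meson finite_Int finite_subset)
    have "(card (A \<inter> B) + w) choose (q - 1) =
        (\<Sum>j\<le>q - 1. (card (A \<inter> B) choose j) * (w choose (q - 1 - j)))"
      by (rule vandermonde[symmetric])
    also have "{..q - 1} = {..<q}" using q by auto
    also have "(\<Sum>j<q. (card (A \<inter> B) choose j) * (w choose (q - 1 - j))) =
        (\<Sum>j<q. \<Sum>J | J \<subseteq> A \<inter> B \<and> card J = j. w choose (q - 1 - card J))"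
    proof (rule sum.cong[OF refl])
      fix j
      have "(\<Sum>J | J \<subseteq> A \<inter> B \<and> card J = j. w choose (q - 1 - card J)) =
          (\<Sum>J | J \<subseteq> A \<inter> B \<and> card J = j. w choose (q - 1 - j))"
        by (intro sum.cong) auto
      thus "(card (A \<inter> B) choose j) * (w choose (q - 1 - j)) =
          (\<Sum>J | J \<subseteq> A \<inter> B \<and> card J = j. w choose (q - 1 - card J))"
        by (simp only: sum_constant n_subsets[OF fin] of_nat_id)
    qed
    also have "\<dots> = (\<Sum>J\<in>(\<Union>j<q. {J. J \<subseteq> A \<inter> B \<and> card J = j}). w choose (q - 1 - card J))"
      using fin by (intro sum.UNION_disjoint[symmetric] ballI) (auto intro: finite_subset[of _ "Pow (A \<inter> B)"])
    also have "(\<Union>j<q. {J. J \<subseteq> A \<inter> B \<and> card J = j}) = {J \<in> S. J \<subseteq> A \<inter> B}"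
      using that by (auto simp: S_def)
    also have "(\<Sum>J \<in> {J \<in> S. J \<subseteq> A \<inter> B}. w choose (q - 1 - card J)) =
        (\<Sum>J\<in>S. (w choose (q - 1 - card J)) * of_bool (J \<subseteq> B) * of_bool (J \<subseteq> A))"
      using finS by (intro sum.mono_neutral_cong_left) auto
    finally show ?thesis .
  qed
  have parity: "odd ((card (A \<inter> B) + w) choose (q - 1)) \<longleftrightarrow> A = B" if "A \<in> F" "B \<in> F" for A B
  proof -
    have "w + k + 1 = q * (k + 1)"
      using q unfolding w_def by (cases q) simp_all
    moreover have le: "card (A \<inter> B) \<le> k"
      using sub[OF that(1)] V by (metis card_mono finite_subset Int_lower1)
    ultimately have "(card (A \<inter> B) + w + 1) + (k - card (A \<inter> B)) = q * (k + 1)" by simp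
    hence "q dvd card (A \<inter> B) + w + 1 \<longleftrightarrow> q dvd k - card (A \<inter> B)"
      by (metis dvd_add_right_iff dvd_add_left_iff dvd_triv_left)
    also have "\<dots> \<longleftrightarrow> card (A \<inter> B) mod q = k mod q"
      using mod_eq_dvd_iff_nat[OF le, of q] by auto
    also have "\<dots> \<longleftrightarrow> A = B"
      using avoid[OF that] sub[OF that(1)] by auto
    finally show ?thesis
      unfolding q_def odd_binomial_two_power_minus_one .
  qed
  \<comment> \<open>By \<open>parity\<close>, only \<open>A = B\<close> contributes an odd term when
    summing over \<open>A \<in> G\<close>. After swapping the sums, \<open>G\<close> enters only
    through \<open>\<phi> G\<close>.\<close>
  have recover: "B \<in> G \<longleftrightarrow>
      odd (\<Sum>J\<in>S. (w choose (q - 1 - card J)) * of_bool (J \<subseteq> B) * of_bool (J \<in> \<phi> G))"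
    if G: "G \<subseteq> F" and B: "B \<in> F" for G B
  proof -
    have finG: "finite G" using G finF by (rule finite_subset)
    have "{A \<in> G. odd ((card (A \<inter> B) + w) choose (q - 1))} = (if B \<in> G then {B} else {})"
      using parity G B by auto
    hence "B \<in> G \<longleftrightarrow> odd (\<Sum>A\<in>G. (card (A \<inter> B) + w) choose (q - 1))"
      using finG by (simp add: even_sum_iff)
    also have "(\<Sum>A\<in>G. (card (A \<inter> B) + w) choose (q - 1)) =
        (\<Sum>A\<in>G. \<Sum>J\<in>S. (w choose (q - 1 - card J)) * of_bool (J \<subseteq> B) * of_bool (J \<subseteq> A))"
      using G sub by (intro sum.cong refl expand) auto
    also have "\<dots> = (\<Sum>J\<in>S. \<Sum>A\<in>G. (w choose (q - 1 - card J)) * of_bool (J \<subseteq> B) * of_bool (J \<subseteq> A))"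
      by (rule sum.swap)
    also have "\<dots> = (\<Sum>J\<in>S. (w choose (q - 1 - card J)) * of_bool (J \<subseteq> B) * card {A \<in> G. J \<subseteq> A})"
      using finG by (simp add: sum_distrib_left[symmetric] Int_def)
    finally show ?thesis
      using finS by (simp add: even_sum_iff \<phi>_def conj_ac cong: conj_cong)
  qed
  have "inj_on \<phi> (Pow F)"
  proof (rule inj_onI)
    fix G H assume GH: "G \<in> Pow F" "H \<in> Pow F" "\<phi> G = \<phi> H"
    have "B \<in> G \<longleftrightarrow> B \<in> H" if "B \<in> F" for B
      using GH recover[of G B] recover[of H B] that by simp
    thus "G = H" using GH by blast
  qed
  moreover have "\<phi> ` Pow F \<subseteq> Pow S" by (auto simp: \<phi>_def)
  ultimately have "card (Pow F) \<le> card (Pow S)"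
    using finS by (intro card_inj_on_le) auto
  hence "card F \<le> card S" using finF finS by (simp add: card_Pow)
  thus ?thesis using V by (simp add: S_def card_subsets_less)
qed

section \<open>Growth of binomial coefficients towards the centre\<close>

text \<open>For \<open>i < h\<close> the ratio of consecutive coefficients,
  \<open>(n - q - i) / (q + i + 1)\<close>, is at least \<open>(2 * M + 3) / (2 * M + 1)\<close>.
  This gains \<open>h\<close> such factors; maximality of the central coefficient covers the
  remaining way to \<open>n / 2\<close>.\<close>

lemma binomial_central_ratio:
  fixes M h :: nat
  defines "n \<equiv> 4 * (M + 1) * h" and "q \<equiv> 2 * M * h"
  shows "(2 * M + 3) ^ h * (n choose q) \<le> (2 * M + 1) ^ h * (n choose (2 * (M + 1) * h))"
proof -
  have step: "(2 * M + 3) * (n choose (q + i)) \<le> (2 * M + 1) * (n choose (q + Suc i))" if "i < h" for i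
  proof -
    have eq: "Suc (q + i) * (n choose Suc (q + i)) = (n - (q + i)) * (n choose (q + i))"
      using binomial_absorption binomial_absorb_comp by metis
    have "(2 * M + 3) * h \<le> n - (q + i)"
      using that by (simp add: n_def q_def algebra_simps)
    hence "((2 * M + 3) * h) * (n choose (q + i)) \<le> Suc (q + i) * (n choose Suc (q + i))"
      unfolding eq by (rule mult_right_mono) simp
    also have "Suc (q + i) \<le> (2 * M + 1) * h"
      using that by (simp add: q_def algebra_simps)
    hence "Suc (q + i) * (n choose Suc (q + i)) \<le> ((2 * M + 1) * h) * (n choose Suc (q + i))"
      by (rule mult_right_mono) simp
    finally have "h * ((2 * M + 3) * (n choose (q + i))) \<le> h * ((2 * M + 1) * (n choose (q + Suc i)))"
      by (simp only: mult_ac add_Suc_right)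
    thus ?thesis by (rule mult_left_le_imp_le) (use that in simp)
  qed
  have "(2 * M + 3) ^ i * (n choose q) \<le> (2 * M + 1) ^ i * (n choose (q + i))" if "i \<le> h" for i
    using that
  proof (induction i)
    case (Suc i)
    have "(2 * M + 3) ^ Suc i * (n choose q) \<le> (2 * M + 3) * ((2 * M + 1) ^ i * (n choose (q + i)))"
      using Suc by (simp only: power_Suc mult.assoc) (intro mult_left_mono, auto)
    also have "\<dots> = (2 * M + 1) ^ i * ((2 * M + 3) * (n choose (q + i)))" by (simp only: mult_ac)
    also have "\<dots> \<le> (2 * M + 1) ^ i * ((2 * M + 1) * (n choose (q + Suc i)))"
      using step[of i] Suc.prems by (intro mult_left_mono) auto
    also have "\<dots> = (2 * M + 1) ^ Suc i * (n choose (q + Suc i))" by (simp only: power_Suc mult_ac)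
    finally show ?case .
  qed simp
  from this[of h] have "(2 * M + 3) ^ h * (n choose q) \<le> (2 * M + 1) ^ h * (n choose (q + h))" by simp
  also have "n choose (q + h) \<le> n choose (2 * (M + 1) * h)"
    using binomial_maximum'[of "2 * (M + 1) * h" "q + h"] by (simp add: n_def algebra_simps)
  finally show ?thesis by simp
qed

section \<open>The kernel and its realisation on a sphere\<close>

text \<open>This is the tangent to \<open>t ^ L\<close> at \<open>- \<tau>\<close>. Divided by
  \<open>\<tau> ^ L\<close> it is Bernoulli's inequality for \<open>(- t / \<tau>) ^ L\<close>,
  valid for every real \<open>t\<close> because \<open>L\<close> is even.\<close>

lemma power_tangent_ge:
  fixes t \<tau> :: real
  assumes "even L" "L > 0" "\<tau> > 0"
  shows "t ^ L + real L * \<tau> ^ (L - 1) * t \<ge> - ((real L - 1) * \<tau> ^ L)"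
proof -
  have L: "\<tau> ^ L = \<tau> * \<tau> ^ (L - 1)" using assms by (metis power_eq_if not_gr0)
  have "\<tau> ^ L * (1 + real L * (- t / \<tau> - 1)) \<le> \<tau> ^ L * (1 + (- t / \<tau> - 1)) ^ L"
    using assms by (intro mult_left_mono Bernoulli_inequality_even) auto
  also have "\<dots> = t ^ L"
    using assms by (simp add: power_mult_distrib[symmetric])
  also have "\<tau> ^ L * (1 + real L * (- t / \<tau> - 1)) = \<tau> ^ L - L * \<tau> ^ (L - 1) * t - L * \<tau> ^ L"
    using assms by (simp add: L field_simps)
  finally show ?thesis using assms by (simp add: of_nat_diff algebra_simps)
qed

text \<open>The functions \<open>g\<close> index the coordinates of an \<open>L\<close>-th tensor
  power, and the inner product of tensor powers is the power of the inner product.\<close>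

lemma sum_PiE_prod_power:
  fixes x y :: "'b \<Rightarrow> real"
  assumes "finite B"
  shows "(\<Sum>g\<in>{..<L} \<rightarrow>\<^sub>E B. (\<Prod>i<L. x (g i)) * (\<Prod>i<L. y (g i))) = (\<Sum>j\<in>B. x j * y j) ^ L"
  using prod_sum_PiE[of "{..<L::nat}" "\<lambda>_. B" "\<lambda>_ j. x j * y j"] assms
  by (simp add: prod.distrib)

text \<open>One extra coordinate, constantly \<open>sqrt (r\<^sup>2 - \<kappa>)\<close>, raises
  every squared norm from \<open>\<kappa>\<close> to \<open>r\<^sup>2\<close> and leaves distances
  unchanged. The strict bound on \<open>card I\<close> reserves room for it.\<close>

lemma gram_family_on_sphere:
  fixes u :: "'a \<Rightarrow> 'i \<Rightarrow> real"
  assumes I: "finite I" "card I < d"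
    and norm: "\<And>A. A \<in> X \<Longrightarrow> (\<Sum>i\<in>I. u A i * u A i) = \<kappa>"
    and r: "\<kappa> \<le> r\<^sup>2" "r \<ge> 0"
  obtains \<psi> where "\<psi> ` X \<subseteq> sphere_d d r"
    and "\<And>A B. A \<in> X \<Longrightarrow> B \<in> X \<Longrightarrow>
      edist d (\<psi> A) (\<psi> B) = sqrt (2 * (\<kappa> - (\<Sum>i\<in>I. u A i * u B i)))"
proof -
  obtain e where e: "bij_betw e {..<card I} I"
    using ex_bij_betw_nat_finite[OF I(1)] by (auto simp: atLeast0LessThan)
  define \<psi> where "\<psi> A i = (if i < card I then u A (e i) else if i = card I then sqrt (r\<^sup>2 - \<kappa>) else 0)"
    for A i
  have split: "(\<Sum>i<d. f i) = (\<Sum>i<card I. f i) + f (card I)"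
    if "\<And>i. i > card I \<Longrightarrow> f i = 0" for f :: "nat \<Rightarrow> real"
  proof -
    have "(\<Sum>i<d. f i) = (\<Sum>i<Suc (card I). f i)"
      using I(2) that by (intro sum.mono_neutral_right) auto
    thus ?thesis by simp
  qed
  have reindex: "(\<Sum>i<card I. u A (e i) * u B (e i)) = (\<Sum>i\<in>I. u A i * u B i)" for A B
    using sum.reindex_bij_betw[OF e] .
  have "\<psi> A \<in> sphere_d d r" if "A \<in> X" for A
  proof -
    have "(\<Sum>i<d. (\<psi> A i)\<^sup>2) = r\<^sup>2"
      using norm[OF that] r reindex[of A A]
      by (subst split) (auto simp: \<psi>_def power2_eq_square)
    thus ?thesis using r I(2) by (simp add: sphere_d_def euclid_pts_def) (simp add: \<psi>_def)
  qed
  moreover have "edist d (\<psi> A) (\<psi> B) = sqrt (2 * (\<kappa> - (\<Sum>i\<in>I. u A i * u B i)))"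
    if "A \<in> X" "B \<in> X" for A B
  proof -
    have "(\<Sum>i<d. (\<psi> A i - \<psi> B i)\<^sup>2) = (\<Sum>i<card I. (u A (e i) - u B (e i))\<^sup>2)"
      by (subst split) (auto simp: \<psi>_def)
    also have "\<dots> = (\<Sum>i<card I. u A (e i) * u A (e i)) + (\<Sum>i<card I. u B (e i) * u B (e i))
        - 2 * (\<Sum>i<card I. u A (e i) * u B (e i))"
      by (simp add: power2_eq_square algebra_simps sum.distrib sum_subtractf sum_distrib_left)
    also have "\<dots> = 2 * (\<kappa> - (\<Sum>i\<in>I. u A i * u B i))"
      unfolding reindex using norm that by simp
    finally show ?thesis by (simp add: edist_def)
  qed
  ultimately show ?thesis using that[of \<psi>] by blast
qed

lemma sign_vector_inner:
  assumes "A \<subseteq> {..<2 * k}" "B \<subseteq> {..<2 * k}" "card A = k" "card B = k"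
  shows "(\<Sum>i<2 * k. (if i \<in> A then 1 else - 1) * (if i \<in> B then 1 else - 1)) =
    4 * real (card (A \<inter> B)) - 2 * real k"
proof -
  have ind: "(\<Sum>i<2 * k. of_bool (i \<in> C)) = real (card C)" if "C \<subseteq> {..<2 * k}" for C
    using that by (simp add: sum.If_cases Int_absorb1 of_bool_def)
  \<comment> \<open>A sign is twice an indicator minus 1; the product is multiplied out.\<close>
  have "(\<Sum>i<2 * k. (if i \<in> A then 1 else - 1) * (if i \<in> B then 1 else - 1)) =
     (\<Sum>i<2 * k. 4 * of_bool (i \<in> A \<inter> B) - 2 * of_bool (i \<in> A) - 2 * of_bool (i \<in> B) + (1::real))"
    by (intro sum.cong) auto
  also have "\<dots> = 4 * real (card (A \<inter> B)) - 2 * real k"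
    using assms ind[of A] ind[of B] ind[of "A \<inter> B"]
    by (simp only: sum.distrib sum_subtractf sum_distrib_left[symmetric]) (auto simp: ind)
  finally show ?thesis .
qed

section \<open>Diameters as suprema\<close>

text \<open>Finiteness bounds the set of distances, so the supremum in \<open>diam_d\<close>
  dominates each of them.\<close>

lemma edist_less_one_if_diam_less_one:
  assumes "finite S" "diam_d d S < 1" "x \<in> S" "y \<in> S"
  shows "edist d x y < 1"
proof -
  have "edist d x y \<le> (SUP p\<in>S \<times> S. edist d (fst p) (snd p))"
    using assms cSUP_upper[of "(x, y)" "S \<times> S" "\<lambda>p. edist d (fst p) (snd p)"] by auto
  thus ?thesis using assms by (auto simp: diam_d_def split: if_splits)
qed

lemma diam_eq_oneI:
  assumes "\<And>x y. x \<in> S \<Longrightarrow> y \<in> S \<Longrightarrow> edist d x y \<le> 1"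
    and "x \<in> S" "y \<in> S" "edist d x y = 1"
  shows "diam_d d S = 1"
proof -
  have "(SUP p\<in>S \<times> S. edist d (fst p) (snd p)) = 1"
    using assms by (intro cSup_eq_maximum) force+
  thus ?thesis using assms by (auto simp: diam_d_def)
qed

section \<open>Choice of parameters and asymptotics\<close>

text \<open>The inequality says that the kernel vectors, scaled to diameter 1, have norm at most
  \<open>r\<close>. As \<tau> tends to 1 it becomes \<open>1 + L \<le> 4 * r\<^sup>2 * L\<close>,
  which holds strictly for large \<open>L\<close> since \<open>4 * r\<^sup>2 > 1\<close>; by
  continuity a large \<open>b\<close> then works.\<close>

lemma exists_kernel_parameters:
  fixes r :: real
  assumes "r > 1 / 2"
  shows "\<exists>L b. even L \<and> L > 0 \<and> b > 0 \<and>
    (let \<tau> = (2 ^ b - 1) / (2 ^ b + 1)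
     in 1 + real L * \<tau> ^ (L - 1) \<le> r\<^sup>2 * (2 * (1 + real L * \<tau> ^ (L - 1) + (real L - 1) * \<tau> ^ L)))"
proof -
  have r: "4 * r\<^sup>2 - 1 > 0"
    using power_strict_mono[OF assms, of 2] by (simp add: power2_eq_square)
  obtain m :: nat where m: "1 / (4 * r\<^sup>2 - 1) < m" using reals_Archimedean2 by blast
  define L where "L = 2 * m"
  have "m > 0" using m r by (intro gr0I) (simp add: divide_less_0_iff)
  hence L: "even L" "L > 0" by (auto simp: L_def)
  define g where "g \<tau> = r\<^sup>2 * (2 * (1 + real L * \<tau> ^ (L - 1) + (real L - 1) * \<tau> ^ L))
      - (1 + real L * \<tau> ^ (L - 1))" for \<tau>
  have "1 < m * (4 * r\<^sup>2 - 1)" using m r by (simp add: pos_divide_less_eq)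
  also have "\<dots> \<le> L * (4 * r\<^sup>2 - 1)" using r by (intro mult_right_mono) (auto simp: L_def)
  finally have gap: "g 1 > 0"
    using L by (simp add: g_def algebra_simps)
  have "(\<lambda>b. (1 - inverse ((2::real) ^ b)) / (1 + inverse (2 ^ b))) \<longlonglongrightarrow> (1 - 0) / (1 + 0)"
    by (intro tendsto_intros LIMSEQ_inverse_realpow_zero) auto
  moreover have "(1 - inverse ((2::real) ^ b)) / (1 + inverse (2 ^ b)) = (2 ^ b - 1) / (2 ^ b + 1)" for b
    by (simp add: divide_simps)
  ultimately have lim: "(\<lambda>b::nat. ((2::real) ^ b - 1) / (2 ^ b + 1)) \<longlonglongrightarrow> 1" by simp
  have "(\<lambda>b::nat. g ((2 ^ b - 1) / (2 ^ b + 1))) \<longlonglongrightarrow> g 1"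
    unfolding g_def by (intro tendsto_intros lim)
  from order_tendstoD(1)[OF this gap] eventually_gt_at_top[of "0::nat"]
  have "\<forall>\<^sub>F b::nat in sequentially. b > 0 \<and> g ((2 ^ b - 1) / (2 ^ b + 1)) > 0"
    by eventually_elim simp
  then obtain b :: nat where "b > 0" "g ((2 ^ b - 1) / (2 ^ b + 1)) > 0"
    using eventually_happens'[OF sequentially_bot] by blast
  thus ?thesis using L by (intro exI[of _ L] exI[of _ b]) (simp add: Let_def g_def)
qed

lemma polynomial_less_exponential_eventually:
  fixes C \<rho> :: real
  assumes "\<rho> > 1"
  shows "\<forall>\<^sub>F h in sequentially. C * real h ^ j < \<rho> ^ h"
proof -
  \<comment> \<open>With this root, \<open>h ^ Suc j / \<rho> ^ h\<close> is a power of
    \<open>h / \<sigma> ^ h\<close>, which tends to 0. \<open>Suc j\<close> keeps the index positive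
    when \<open>j = 0\<close>.\<close>
  define \<sigma> where "\<sigma> = root (Suc j) \<rho>"
  have \<sigma>: "\<sigma> > 1" "\<sigma> ^ Suc j = \<rho>"
    using assms by (auto simp: \<sigma>_def simp del: power_Suc)
  have "(\<lambda>h. \<bar>C\<bar> * (real h / \<sigma> ^ h) ^ Suc j) \<longlonglongrightarrow> \<bar>C\<bar> * 0 ^ Suc j"
    using \<sigma>(1) by (intro tendsto_intros lim_n_over_pown) auto
  hence "\<forall>\<^sub>F h in sequentially. \<bar>C\<bar> * (real h / \<sigma> ^ h) ^ Suc j < 1"
    by (rule order_tendstoD(2)) simp
  thus ?thesis using eventually_gt_at_top[of 0]
  proof eventually_elim
    case (elim h)
    have "C * real h ^ j \<le> \<bar>C\<bar> * real h ^ Suc j"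
      using elim by (intro mult_mono power_increasing) auto
    also have "(\<sigma> ^ h) ^ Suc j = \<rho> ^ h"
      unfolding \<sigma>(2)[symmetric] by (simp only: power_mult[symmetric] mult.commute)
    hence "\<bar>C\<bar> * real h ^ Suc j < \<rho> ^ h"
      using elim assms by (simp add: power_divide field_simps del: power_Suc)
    finally show ?case .
  qed
qed

text \<open>The construction lives at sparse scales \<open>c\<close>; the largest scale fitting into
  dimension \<open>d\<close> exists because \<open>c \<le> E c\<close> leaves finitely many
  candidates.\<close>

lemma dyadic_scale:
  fixes E :: "nat \<Rightarrow> nat"
  assumes "\<And>c. c \<le> E c" "E c0 \<le> d"
  obtains c where "c \<ge> c0" "E c \<le> d" "d < E (Suc c)"
proof -
  have "finite {c. c \<ge> c0 \<and> E c \<le> d}"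
    by (rule finite_subset[of _ "{..d}"]) (use assms(1) in \<open>auto intro: order_trans\<close>)
  moreover define c where "c = Max {c. c \<ge> c0 \<and> E c \<le> d}"
  ultimately have "c \<in> {c. c \<ge> c0 \<and> E c \<le> d}" "\<And>e. e \<in> {c. c \<ge> c0 \<and> E c \<le> d} \<Longrightarrow> e \<le> c"
    using assms(2) Max_in[of "{c. c \<ge> c0 \<and> E c \<le> d}"] by auto
  thus ?thesis using that[of c] by (metis (mono_tags, lifting) le_SucI linorder_not_less mem_Collect_eq not_less_eq_eq)
qed

section \<open>The counterexample in a fixed dimension\<close>

text \<open>Three conditions make a scale usable: \<open>radius\<close> fits the vectors into the
  sphere, \<open>dim\<close> provides \<open>n ^ L + n\<close> coordinates and a spare one, and
  \<open>count\<close> says that \<open>d + 1\<close> families of Frankl-Wilson size cannot cover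
  all \<open>k\<close>-subsets.\<close>

lemma borsuk_counterexample_on_sphere:
  fixes r \<tau> :: real and b c L d M h n :: nat
  defines "M \<equiv> 2 ^ b" and "h \<equiv> 2 ^ c"
  defines "\<tau> \<equiv> (real M - 1) / (real M + 1)" and "n \<equiv> 4 * (M + 1) * h"
  assumes b: "b > 0" and L: "even L" "L > 0" and r: "r \<ge> 0"
    and radius: "1 + real L * \<tau> ^ (L - 1) \<le> r\<^sup>2 * (2 * (1 + real L * \<tau> ^ (L - 1) + (real L - 1) * \<tau> ^ L))"
    and dim: "n ^ L + n < d"
    and count: "(d + 1) * (2 * M * h) * (2 * M + 1) ^ h < (2 * M + 3) ^ h"
  shows "\<exists>\<Omega>. \<Omega> \<subseteq> sphere_d d r \<and> diam_d d \<Omega> = 1 \<and>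
           \<not> (\<exists>P :: nat \<Rightarrow> (nat \<Rightarrow> real) set.
                 \<Omega> = (\<Union>i<d+1. P i) \<and> (\<forall>i<d+1. diam_d d (P i) < 1))"
proof -
  define k where "k = 2 * (M + 1) * h"
  define s where "s = 2 * h"
  define q where "q = 2 * M * h"
  define X where "X = {A. A \<subseteq> {..<n} \<and> card A = k}"
  define \<mu> where "\<mu> = real L * \<tau> ^ (L - 1)"
  \<comment> \<open>The kernel's value on the diagonal minus its minimum, hence half the largest
    squared distance before scaling; the factor \<open>\<alpha>\<close> below normalises that
    distance to 1.\<close>
  define D where "D = 1 + \<mu> + (real L - 1) * \<tau> ^ L"
  define \<alpha> where "\<alpha> = 1 / (2 * D)"
  define v where "v A i = (if i \<in> A then 1 else - 1) / sqrt n" for A :: "nat set" and i :: nat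
  define T where "T A B = (\<Sum>i<n. v A i * v B i)" for A B
  define I where "I = (({..<L} \<rightarrow>\<^sub>E {..<n}) <+> {..<n})"
  define u where "u A i = (case i of Inl g \<Rightarrow> sqrt \<alpha> * (\<Prod>i<L. v A (g i)) | Inr i \<Rightarrow> sqrt (\<alpha> * \<mu>) * v A i)"
    for A and i :: "(nat \<Rightarrow> nat) + nat"
  have M: "M \<ge> 2" using b self_le_power[of 2 b] by (simp add: M_def)
  have h: "h \<ge> 1" by (simp add: h_def)
  have kpos: "k > 0" and nk: "n = 2 * k" and ks: "k = (M + 1) * s" and kqs: "k = q + s" and "s < q" "s > 0"
    using M h by (auto simp: k_def n_def s_def q_def algebra_simps)
  have q2: "q = 2 ^ (b + c + 1)" by (simp add: q_def M_def h_def power_add)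
  have \<tau>: "\<tau> > 0" using M by (simp add: \<tau>_def)
  have \<mu>: "\<mu> \<ge> 0" using \<tau> by (simp add: \<mu>_def)
  have D: "D > 0" using \<tau> \<mu> L by (simp add: D_def add_pos_nonneg)
  have \<alpha>: "\<alpha> > 0" using D by (simp add: \<alpha>_def)
  have finX: "finite X" by (simp add: X_def)
  have T: "T A B = 2 * real (card (A \<inter> B)) / real k - 1" if "A \<in> X" "B \<in> X" for A B
  proof -
    have "T A B = (\<Sum>i<2 * k. (if i \<in> A then 1 else - 1) * (if i \<in> B then 1 else - 1)) / real n"
      using kpos by (simp add: T_def v_def nk sum_divide_distrib)
    also have "\<dots> = (4 * real (card (A \<inter> B)) - 2 * real k) / real n"
      using that by (subst sign_vector_inner) (auto simp: X_def nk)
    finally show ?thesis using kpos by (simp add: nk field_simps)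
  qed
  have T_self: "T A A = 1" if "A \<in> X" for A
    using T[OF that that] that kpos by (simp add: X_def)
  have sqrt_pair: "(sqrt a * x) * (sqrt a * y) = a * (x * y)" if "a \<ge> 0" for a x y :: real
  proof -
    have "(sqrt a * x) * (sqrt a * y) = (sqrt a * sqrt a) * (x * y)" by (simp only: mult_ac)
    thus ?thesis using that by simp
  qed
  have gram: "(\<Sum>i\<in>I. u A i * u B i) = \<alpha> * (T A B ^ L + \<mu> * T A B)" for A B
  proof -
    have "(\<Sum>g\<in>{..<L} \<rightarrow>\<^sub>E {..<n}. u A (Inl g) * u B (Inl g)) = \<alpha> * T A B ^ L"
      using \<alpha> unfolding T_def sum_PiE_prod_power[OF finite_lessThan, symmetric]
      by (simp add: u_def sum_distrib_left sqrt_pair)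
    moreover have "(\<Sum>i<n. u A (Inr i) * u B (Inr i)) = \<alpha> * \<mu> * T A B"
      using \<alpha> \<mu> by (simp add: u_def T_def sum_distrib_left sqrt_pair del: real_sqrt_mult)
    ultimately show ?thesis
      by (simp add: I_def sum.Plus finite_PiE algebra_simps)
  qed
  have "finite I" "card I < d"
    using dim by (auto simp: I_def finite_PiE card_Plus card_PiE)
  moreover have "(\<Sum>i\<in>I. u A i * u A i) = \<alpha> * (1 + \<mu>)" if "A \<in> X" for A
    using T_self[OF that] by (simp add: gram)
  moreover have "\<alpha> * (1 + \<mu>) \<le> r\<^sup>2"
    using radius D unfolding \<alpha>_def by (simp add: pos_divide_le_eq D_def \<mu>_def)
  ultimately obtain \<psi> where sphere: "\<psi> ` X \<subseteq> sphere_d d r"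
    and dist: "\<And>A B. A \<in> X \<Longrightarrow> B \<in> X \<Longrightarrow>
      edist d (\<psi> A) (\<psi> B) = sqrt (2 * (\<alpha> * (1 + \<mu>) - (\<Sum>i\<in>I. u A i * u B i)))"
    using gram_family_on_sphere[of I d X u "\<alpha> * (1 + \<mu>)" r] r by blast
  have dist': "edist d (\<psi> A) (\<psi> B) = sqrt ((1 + \<mu> - (T A B ^ L + \<mu> * T A B)) / D)"
    if "A \<in> X" "B \<in> X" for A B
    using D by (simp add: dist[OF that] gram \<alpha>_def field_simps)
  have dist_le: "edist d (\<psi> A) (\<psi> B) \<le> 1" if "A \<in> X" "B \<in> X" for A B
    using power_tangent_ge[OF L \<tau>, of "T A B"] D
    by (simp add: dist'[OF that]) (simp add: D_def \<mu>_def)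
  have dist_eq: "edist d (\<psi> A) (\<psi> B) = 1" if "A \<in> X" "B \<in> X" "card (A \<inter> B) = s" for A B
  proof -
    have "T A B = - \<tau>"
    proof -
      have "2 * real (card (A \<inter> B)) / real k = 2 / (real M + 1)"
        using that(3) \<open>s > 0\<close> by (simp only: ks of_nat_mult) (simp add: add.commute)
      moreover have "2 / (real M + 1) - 1 = - \<tau>"
        unfolding \<tau>_def by (simp add: divide_simps)
      ultimately show ?thesis using T[OF that(1,2)] by simp
    qed
    moreover have "\<tau> ^ L = \<tau> * \<tau> ^ (L - 1)" using L(2) by (metis power_eq_if not_gr0)
    ultimately have "1 + \<mu> - (T A B ^ L + \<mu> * T A B) = D"
      using L by (simp add: D_def \<mu>_def of_nat_diff algebra_simps)
    thus ?thesis using D by (simp add: dist'[OF that(1,2)])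
  qed
  \<comment> \<open>Two intervals of length \<open>k\<close> overlapping in \<open>s\<close> points
    show that distance 1 is attained.\<close>
  define A0 where "A0 = {..<k}"
  define B0 where "B0 = {k - s..<2 * k - s}"
  have "A0 \<in> X" "B0 \<in> X" using kqs by (auto simp: A0_def B0_def X_def nk)
  moreover have "A0 \<inter> B0 = {k - s..<k}" using kqs by (auto simp: A0_def B0_def)
  hence "card (A0 \<inter> B0) = s" using kqs by simp
  ultimately have diam: "diam_d d (\<psi> ` X) = 1"
    by (intro diam_eq_oneI[of _ _ "\<psi> A0" "\<psi> B0"]) (auto intro: dist_le dist_eq)
  have no_partition: False
    if P: "\<psi> ` X = (\<Union>i<d + 1. P i)" and small: "\<And>i. i < d + 1 \<Longrightarrow> diam_d d (P i) < 1"
    for P :: "nat \<Rightarrow> (nat \<Rightarrow> real) set"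
  proof -
    \<comment> \<open>The pieces are pulled back to \<open>X\<close>, so that sets rather than image
      points are counted.\<close>
    define F where "F i = {A \<in> X. \<psi> A \<in> P i}" for i
    have "card (F i) \<le> q * (n choose q)" if i: "i < d + 1" for i
    proof -
      have "finite (P i)"
        using finX P i by (metis (no_types, lifting) UN_upper finite_imageI finite_subset lessThan_iff)
      hence lt: "edist d (\<psi> A) (\<psi> B) < 1" if "A \<in> F i" "B \<in> F i" for A B
        using edist_less_one_if_diam_less_one small[OF i] that by (auto simp: F_def)
      have "card (A \<inter> B) mod 2 ^ (b + c + 1) \<noteq> k mod 2 ^ (b + c + 1)"
        if AB: "A \<in> F i" "B \<in> F i" "A \<noteq> B" for A B
      proof
        \<comment> \<open>Since \<open>k = q + s\<close>, the intersection size is \<open>s\<close>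
          modulo \<open>q\<close>; for distinct sets it is below \<open>q + s\<close>, so it equals
          \<open>s\<close> and the distance would be 1.\<close>
        assume "card (A \<inter> B) mod 2 ^ (b + c + 1) = k mod 2 ^ (b + c + 1)"
        hence "card (A \<inter> B) mod q = s"
          unfolding q2[symmetric] using kqs \<open>s < q\<close> by simp
        moreover have AX: "A \<in> X" "B \<in> X" using AB by (auto simp: F_def)
        have fin: "finite A" "finite B" "card A = k" "card B = k"
          using AX kpos by (auto simp: X_def intro: card_ge_0_finite)
        have "A \<inter> B \<subset> A" using AB(3) fin by (metis Int_lower1 Int_lower2 card_subset_eq psubsetI)
        hence "card (A \<inter> B) < q + s" using fin kqs psubset_card_mono by metis
        ultimately have "card (A \<inter> B) = s"
          using \<open>s < q\<close> by (cases "card (A \<inter> B) < q") (auto simp: le_mod_geq not_less)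
        with dist_eq[OF AX] lt[OF AB(1,2)] show False by simp
      qed
      hence "card (F i) \<le> (\<Sum>j<2 ^ (b + c + 1). card {..<n} choose j)"
        by (intro frankl_wilson_two_power[where k = k]) (auto simp: F_def X_def)
      \<comment> \<open>Binomial coefficients increase up to \<open>n / 2 = k\<close>, and
        \<open>q \<le> k\<close>.\<close>
      also have "\<dots> \<le> (\<Sum>j<q. n choose q)"
        unfolding q2[symmetric] using kqs
        by (simp only: card_lessThan, intro sum_mono binomial_mono) (auto simp: nk)
      finally show ?thesis by simp
    qed
    hence bound: "(\<Sum>i<d + 1. card (F i)) \<le> (\<Sum>i<d + 1. q * (n choose q))"
      by (intro sum_mono) auto
    have "X = (\<Union>i<d + 1. F i)" using P by (auto simp: F_def)
    hence "card X \<le> (\<Sum>i<d + 1. card (F i))" by (metis card_UN_le finite_lessThan)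
    also note bound
    finally have "n choose k \<le> (d + 1) * (q * (n choose q))"
      by (simp add: X_def n_subsets)
    hence "(2 * M + 1) ^ h * (n choose k) \<le> (2 * M + 1) ^ h * ((d + 1) * (q * (n choose q)))"
      by (rule mult_left_mono) simp
    moreover have "(2 * M + 3) ^ h * (n choose q) \<le> (2 * M + 1) ^ h * (n choose k)"
      unfolding n_def q_def k_def by (rule binomial_central_ratio)
    ultimately have "(2 * M + 3) ^ h * (n choose q) \<le> ((d + 1) * q * (2 * M + 1) ^ h) * (n choose q)"
      by (simp only: mult_ac) 
    moreover have "n choose q > 0" using kqs nk by simp
    ultimately show False using count by (simp add: q_def)
  qed
  show ?thesis
    using sphere diam no_partition by (intro exI[of _ "\<psi> ` X"]) blast
qed

section \<open>Passage to all large dimensions\<close>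

theorem theorem1:
  fixes r :: real
  assumes "r > 1/2"
  shows "\<exists>d0::nat. \<forall>d\<ge>d0. \<exists>\<Omega>. \<Omega> \<subseteq> sphere_d d r \<and> diam_d d \<Omega> = 1 \<and>
           \<not> (\<exists>P :: nat \<Rightarrow> (nat \<Rightarrow> real) set.
                 \<Omega> = (\<Union>i<d+1. P i) \<and> (\<forall>i<d+1. diam_d d (P i) < 1))"
proof -
  obtain L b where L: "even L" "L > 0" and b: "b > 0"
    and radius: "let \<tau> = (2 ^ b - 1) / (2 ^ b + 1)
     in 1 + real L * \<tau> ^ (L - 1) \<le> r\<^sup>2 * (2 * (1 + real L * \<tau> ^ (L - 1) + (real L - 1) * \<tau> ^ L))"
    using exists_kernel_parameters[OF assms] by blast
  define M :: nat where "M = 2 ^ b"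
  define N where "N c = 4 * (M + 1) * 2 ^ c" for c :: nat
  \<comment> \<open>The least dimension that accommodates scale \<open>c\<close>.\<close>
  define E where "E c = N c ^ L + N c + 1" for c
  define \<rho> where "\<rho> = (2 * real M + 3) / (2 * real M + 1)"
  have "\<rho> > 1" by (simp add: \<rho>_def)
  moreover have "filterlim (\<lambda>c. 2 ^ c :: nat) at_top sequentially"
    by (rule filterlim_subseq) (simp add: strict_mono_def)
  \<comment> \<open>The left side is \<open>3 * N (Suc c) ^ Suc L\<close>. It bounds
    \<open>(d + 1) * (2 * M * 2 ^ c)\<close> for all \<open>d < E (Suc c)\<close>: \<open>L\<close>
    factors and the 3 come from \<open>d + 1\<close>, the last factor from
    \<open>2 * M * 2 ^ c\<close>.\<close>
  ultimately have "\<forall>\<^sub>F c in sequentially. 3 * real (8 * (M + 1)) ^ Suc L * real (2 ^ c) ^ Suc L < \<rho> ^ (2 ^ c)"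
    using eventually_compose_filterlim[OF polynomial_less_exponential_eventually] by blast
  then obtain c0 where c0: "\<And>c. c \<ge> c0 \<Longrightarrow>
      3 * real (8 * (M + 1)) ^ Suc L * real (2 ^ c) ^ Suc L < \<rho> ^ (2 ^ c)"
    by (auto simp: eventually_at_top_linorder)
  have "\<exists>\<Omega>. \<Omega> \<subseteq> sphere_d d r \<and> diam_d d \<Omega> = 1 \<and>
           \<not> (\<exists>P :: nat \<Rightarrow> (nat \<Rightarrow> real) set.
                 \<Omega> = (\<Union>i<d+1. P i) \<and> (\<forall>i<d+1. diam_d d (P i) < 1))"
    if d: "d \<ge> E c0" for d
  proof -
    have "c \<le> E c" for c
    proof -
      have "c \<le> 2 ^ c" by (simp add: less_imp_le)
      also have "\<dots> \<le> N c" by (simp add: N_def)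
      finally show ?thesis by (simp add: E_def)
    qed
    then obtain c where c: "c \<ge> c0" "E c \<le> d" "d < E (Suc c)"
      using dyadic_scale[of E c0 d] d by blast
    define h :: nat where "h = 2 ^ c"
    have NSuc: "N (Suc c) = 8 * (M + 1) * h" by (simp add: N_def h_def)
    have N1: "N (Suc c) \<ge> 1" by (simp add: NSuc h_def)
    have "d + 1 \<le> N (Suc c) ^ L + N (Suc c) + 1" using c(3) by (simp add: E_def)
    also have "\<dots> \<le> 3 * N (Suc c) ^ L"
      using N1 L(2) self_le_power[of "N (Suc c)" L] one_le_power[of "N (Suc c)" L] by linarith
    finally have "(d + 1) * (2 * M * h) \<le> (3 * N (Suc c) ^ L) * N (Suc c)"
      by (rule mult_mono) (auto simp: NSuc)
    also have "\<dots> = 3 * (8 * (M + 1)) ^ Suc L * h ^ Suc L"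
      by (simp add: NSuc power_mult_distrib[symmetric] mult_ac)
    finally have "real ((d + 1) * (2 * M * h)) \<le> real (3 * (8 * (M + 1)) ^ Suc L * h ^ Suc L)"
      by (rule of_nat_mono)
    also have "\<dots> < \<rho> ^ h"
      using c0[OF c(1)] unfolding h_def by (simp del: power_Suc)
    finally have "real ((d + 1) * (2 * M * h)) * (2 * real M + 1) ^ h < (2 * real M + 3) ^ h"
      by (simp add: \<rho>_def power_divide pos_less_divide_eq)
    hence "real ((d + 1) * (2 * M * h) * (2 * M + 1) ^ h) < real ((2 * M + 3) ^ h)"
      by (simp add: add.commute)
    hence "(d + 1) * (2 * M * h) * (2 * M + 1) ^ h < (2 * M + 3) ^ h"
      by (simp only: of_nat_less_iff)
    moreover have "N c ^ L + N c < d" using c(2) by (simp add: E_def)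
    ultimately show ?thesis
      using borsuk_counterexample_on_sphere[OF b L, of r c d] radius assms
      by (simp add: M_def h_def N_def Let_def)
  qed
  thus ?thesis by blast
qed

end
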